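(* Consider the recurrent relation $\mathfrak{y}_{n+1}=\mathfrak{a}_{n}\mathfrak{y}_{n}-\mathfrak{y}_{n-1}$ ($n\ge 1$) with unknown sequence $(\mathfrak{y}_k)_{k\ge 0}\subset M_l(\mathbb{C})$, where the sequence $(\mathfrak{a}_{n})_{n\ge 1}\subset M_l(\mathbb{C})$ is $N$-periodic. Suppose that the matrix $\mathfrak{m}\in M_l(\mathbb{C})$ satisfies $\mathfrak{m}\mathfrak{a}_{k}=\mathfrak{a}_k\mathfrak{m}$ for $k=1,2,\ldots,N$. Then $\mathfrak{m}$ is the monodromy matrix of every solution (that is, every solution $(\mathfrak{y}_{k})_{k\ge 0}$ satisfies $\mathfrak{y}_{k+N}=\mathfrak{m}\mathfrak{y}_{k}$ for all $k\ge 0$) if and only if $$\mathfrak{p}_{N-1}(\mathfrak{a}_{1},\ldots,\mathfrak{a}_{N-1})=O,\qquad \mathfrak{p}_{N-2}(\mathfrak{a}_{2},\ldots,\mathfrak{a}_{N-1})=-\mathfrak{m},$$ and $$\mathfrak{p}_{N}(\mathfrak{a}_{1},\ldots,\mathfrak{a}_{N})=\mathfrak{m},\qquad \mathfrak{p}_{N-1}(\mathfrak{a}_{2},\ldots,\mathfrak{a}_{N})=O.$$ Moreover, in this case $$M(\mathfrak{a}_{1},\ldots,\mathfrak{a}_{N})=\begin{pmatrix} \mathfrak{m} & O\\ O & \mathfrak{m}\end{pmatrix}.$$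
   Context: $I$, $O$ are the $l\times l$ identity and zero matrices. The left matrix signed Chebyshev polynomials are defined, for a finite sequence of $l\times l$ matrices $(\mathfrak{a}_1,\ldots,\mathfrak{a}_m)$, by $\mathfrak{p}_{-1}=O$, $\mathfrak{p}_{0}=I$ and $$\mathfrak{p}_{m}(\mathfrak{a}_{1},\ldots,\mathfrak{a}_{m})=\mathfrak{a}_{m}\mathfrak{p}_{m-1}(\mathfrak{a}_{1},\ldots,\mathfrak{a}_{m-1})-\mathfrak{p}_{m-2}(\mathfrak{a}_{1},\ldots,\mathfrak{a}_{m-2}),\quad m\ge 1;$$ $\mathfrak{p}_{r}(\mathfrak{a}_{2},\ldots,\mathfrak{a}_{r+1})$ denotes the same polynomial evaluated at the shifted sequence. Also $$M(\mathfrak{a}_{1},\ldots,\mathfrak{a}_{N})=\begin{pmatrix} \mathfrak{a}_{N} & -I\\ I & O\end{pmatrix}\cdots\begin{pmatrix} \mathfrak{a}_{1} & -I\\ I & O\end{pmatrix}.$$ *)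

theory Defs
  imports Complex_Main "Jordan_Normal_Form.Matrix"
begin

text \<open>
  Throughout, the space of complex \<open>l \<times> l\<close> matrices is \<open>carrier_mat l l\<close>, and a sequence
  \<open>a\<^sub>1, a\<^sub>2, \<dots>\<close> is a function \<open>a\<close> on \<open>nat\<close> whose value at \<open>0\<close> is never used.
\<close>

text \<open>
  \<open>left_cheb l m a\<close> is \<open>p\<^sub>m(a\<^sub>1, \<dots>, a\<^sub>m)\<close>; it only reads \<open>a 1, \<dots>, a m\<close>. The index is an integer
  because the recursion starts at \<open>m = -1\<close>; values \<open>m < -1\<close> are junk.
\<close>

function left_cheb :: "nat \<Rightarrow> int \<Rightarrow> (nat \<Rightarrow> complex mat) \<Rightarrow> complex mat" where
  "left_cheb l m a =
     (if m < 0 then 0\<^sub>m l l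
      else if m = 0 then 1\<^sub>m l
      else a (nat m) * left_cheb l (m - 1) a - left_cheb l (m - 2) a)"
  by pat_completeness auto
termination
  by (relation "measure (\<lambda>(l, m, a). nat (m + 1))") auto

declare left_cheb.simps [simp del]

lemma left_cheb_minus_one: "left_cheb l (- 1) a = 0\<^sub>m l l"
  by (simp add: left_cheb.simps)

lemma left_cheb_0: "left_cheb l 0 a = 1\<^sub>m l"
  by (simp add: left_cheb.simps)

lemma left_cheb_rec:
  "1 \<le> m \<Longrightarrow> left_cheb l m a = a (nat m) * left_cheb l (m - 1) a - left_cheb l (m - 2) a"
  by (subst left_cheb.simps) simp

definition shift_seq :: "(nat \<Rightarrow> 'a) \<Rightarrow> nat \<Rightarrow> 'a" where
  "shift_seq a = (\<lambda>n. a (n + 1))"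

text \<open>\<open>transfer_mat l a N\<close> is the product \<open>M(a\<^sub>1, \<dots>, a\<^sub>N)\<close>, with the factor of \<open>a\<^sub>N\<close> leftmost.\<close>

fun transfer_mat :: "nat \<Rightarrow> (nat \<Rightarrow> complex mat) \<Rightarrow> nat \<Rightarrow> complex mat" where
  "transfer_mat l a 0 = 1\<^sub>m (l + l)"
| "transfer_mat l a (Suc n) =
     four_block_mat (a (Suc n)) (- 1\<^sub>m l) (1\<^sub>m l) (0\<^sub>m l l) * transfer_mat l a n"

definition is_solution :: "nat \<Rightarrow> (nat \<Rightarrow> complex mat) \<Rightarrow> (nat \<Rightarrow> complex mat) \<Rightarrow> bool" where
  "is_solution l a y \<longleftrightarrow>
     (\<forall>k. y k \<in> carrier_mat l l) \<and> (\<forall>n\<ge>1. y (n + 1) = a n * y n - y (n - 1))"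

definition is_monodromy :: "nat \<Rightarrow> complex mat \<Rightarrow> (nat \<Rightarrow> complex mat) \<Rightarrow> bool" where
  "is_monodromy N M y \<longleftrightarrow> (\<forall>k. y (k + N) = M * y k)"

end

theory Submission imports Defs begin

text \<open>
  The sequences \<open>p\<^sub>n\<^sub>-\<^sub>1(a\<^sub>1, \<dots>, a\<^sub>n\<^sub>-\<^sub>1)\<close> and \<open>- p\<^sub>n\<^sub>-\<^sub>2(a\<^sub>2, \<dots>, a\<^sub>n\<^sub>-\<^sub>1)\<close> are the
  solutions with initial values \<open>(O, I)\<close> and \<open>(I, O)\<close>, and every solution is a combination
  of the two with right coefficients \<open>y\<^sub>1\<close> and \<open>y\<^sub>0\<close>. The four conditions say exactly that
  \<open>y\<^sub>N = m y\<^sub>0\<close> and \<open>y\<^sub>N\<^sub>+\<^sub>1 = m y\<^sub>1\<close> for these two, hence for all, solutions; since \<open>m\<close> commutes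
  with all the coefficients, this propagates along the recurrence.
\<close>

lemma uminus_zero_mat [simp]: "- 0\<^sub>m nr nc = (0\<^sub>m nr nc :: 'a::group_add mat)"
  by (intro eq_matI) auto

lemma minus_minus_swap_mat:
  fixes A B C D :: "'a::ab_group_add mat"
  assumes "A \<in> carrier_mat nr nc" "B \<in> carrier_mat nr nc"
    "C \<in> carrier_mat nr nc" "D \<in> carrier_mat nr nc"
  shows "(A - B) - (C - D) = (A - C) - (B - D)"
  using assms by (intro eq_matI) auto

lemma left_cheb_carrier [simp]:
  assumes "\<And>n. n \<ge> 1 \<Longrightarrow> a n \<in> carrier_mat l l"
  shows "left_cheb l j a \<in> carrier_mat l l"
proof (induction "nat (j + 1)" arbitrary: j rule: less_induct)
  case less
  show ?case
  proof (cases "j \<ge> 1")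
    case True
    have "left_cheb l (j - 1) a \<in> carrier_mat l l" "left_cheb l (j - 2) a \<in> carrier_mat l l"
      using True by (auto intro!: less)
    moreover have "a (nat j) \<in> carrier_mat l l" using True by (intro assms) auto
    ultimately show ?thesis using True by (simp add: left_cheb_rec mult_carrier_mat minus_carrier_mat)
  next
    case False
    then show ?thesis by (subst left_cheb.simps) auto
  qed
qed

lemma left_cheb_Suc:
  "left_cheb l (int (Suc n)) a = a (Suc n) * left_cheb l (int n) a - left_cheb l (int n - 1) a"
proof -
  have "nat (1 + int n) = Suc n" by simp
  then show ?thesis by (subst left_cheb_rec) (auto simp: algebra_simps)
qed

text \<open>The last argument of p_{n+1}(a_2, ..., a_{n+2}) is a_{n+2}, which is also the
  coefficient that leads to p_{n+2}(a_1, ..., a_{n+2}). Lowering the degree of the shifted family by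
  one therefore puts both families into the same recurrence.\<close>

lemma left_cheb_shift_Suc:
  "left_cheb l (int (Suc n)) (shift_seq a) =
     a (n + 2) * left_cheb l (int n) (shift_seq a) - left_cheb l (int n - 1) (shift_seq a)"
  by (subst left_cheb_Suc) (simp add: shift_seq_def)

lemma shift_seq_carrier:
  assumes "\<And>n. n \<ge> 1 \<Longrightarrow> a n \<in> carrier_mat l l" and "n \<ge> 1"
  shows "shift_seq a n \<in> carrier_mat l l"
  using assms by (simp add: shift_seq_def)

text \<open>Delaying the index by one puts p_{-1} = O and p_0 = I at places 0 and 1, and the
  defining recursion of p_n becomes the recurrence at n.\<close>

lemma is_solution_left_cheb:
  assumes a: "\<And>n. n \<ge> 1 \<Longrightarrow> a n \<in> carrier_mat l l"
  shows "is_solution l a (\<lambda>n. left_cheb l (int n - 1) a)"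
  unfolding is_solution_def
proof (intro conjI allI impI)
  fix n :: nat assume "n \<ge> 1"
  then obtain k where "n = Suc k" by (cases n) auto
  then show "left_cheb l (int (n + 1) - 1) a =
      a n * left_cheb l (int n - 1) a - left_cheb l (int (n - 1) - 1) a"
    using left_cheb_Suc[of l k a] by simp
qed (use a in simp)

text \<open>The value at \<open>0\<close> is given separately: the recursion would force \<open>p\<^sub>-\<^sub>2 = - I\<close>, but
  \<^const>\<open>left_cheb\<close> returns zero there.\<close>

lemma is_solution_left_cheb_shift:
  assumes a: "\<And>n. n \<ge> 1 \<Longrightarrow> a n \<in> carrier_mat l l"
  shows "is_solution l a (\<lambda>n. if n = 0 then 1\<^sub>m l else - left_cheb l (int n - 2) (shift_seq a))"
    (is "is_solution l a ?v")
  unfolding is_solution_def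
proof (intro conjI allI impI)
  have Q: "left_cheb l j (shift_seq a) \<in> carrier_mat l l" for j
    by (intro left_cheb_carrier shift_seq_carrier a)
  show "?v k \<in> carrier_mat l l" for k using Q by simp
  fix n :: nat assume "n \<ge> 1"
  then consider "n = 1" | k where "n = k + 2"
    by (metis add_2_eq_Suc' le_antisym not_less_eq_eq One_nat_def Suc_le_D)
  then show "?v (n + 1) = a n * ?v n - ?v (n - 1)"
  proof cases
    \<comment> \<open>Only here does the separate value at 0 enter: a_1 O - I = -I = -p_0.\<close>
    case 1
    then show ?thesis using a[of 1] by (auto simp: left_cheb_0 left_cheb_minus_one)
  next
    case 2
    have c: "a (k + 2) \<in> carrier_mat l l" by (intro a) simp
    show ?thesis
      using 2 left_cheb_shift_Suc[of l k a] c Q[of "int k"] Q[of "int k - 1"]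
      by (intro eq_matI) (auto simp: algebra_simps)
  qed
qed

text \<open>Both sides satisfy the same second-order recurrence in n and agree for the first two n.
  The initial values stand on the right because the recurrence multiplies by a_n from the left.
  Index 0 is left out since the coefficient of \<open>y 0\<close> there would have to be -p_{-2} =
  I.\<close>

lemma solution_eq_left_cheb:
  assumes a: "\<And>n. n \<ge> 1 \<Longrightarrow> a n \<in> carrier_mat l l" and y: "is_solution l a y"
  shows "y (Suc n) = left_cheb l (int n) a * y 1 - left_cheb l (int n - 1) (shift_seq a) * y 0"
proof -
  have yc [simp]: "y k \<in> carrier_mat l l" for k
    using y by (simp add: is_solution_def)
  have rec: "y (k + 2) = a (k + 1) * y (k + 1) - y k" for k
    using y[unfolded is_solution_def] by (auto dest: spec[of _ "k + 1"])
  have P [simp]: "left_cheb l j a \<in> carrier_mat l l" for j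
    by (intro left_cheb_carrier a)
  have Q [simp]: "left_cheb l j (shift_seq a) \<in> carrier_mat l l" for j
    by (intro left_cheb_carrier shift_seq_carrier a)
  show ?thesis
  proof (induction n rule: induct_nat_012)
    case 0
    have "1\<^sub>m l * y 1 - 0\<^sub>m l l * y 0 = y 1"
      using carrier_matD[OF yc[of 0]] carrier_matD[OF yc[of 1]] by (intro eq_matI) auto
    then show ?case by (simp add: left_cheb_0 left_cheb_minus_one)
  next
    case 1
    have "left_cheb l 1 a = a 1"
      using left_cheb_Suc[of l 0 a] a[of 1] by (auto simp: left_cheb_0 left_cheb_minus_one)
    then show ?case using rec[of 0] by (simp add: left_cheb_0 left_mult_one_mat[OF yc] numeral_2_eq_2)
  next
    case (ge2 n)
    let ?A = "a (n + 2)"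
    let ?P = "\<lambda>j. left_cheb l j a" and ?Q = "\<lambda>j. left_cheb l j (shift_seq a)"
    have A [simp]: "?A \<in> carrier_mat l l" by (intro a) simp
    have "y (Suc (Suc (Suc n))) = ?A * y (Suc (Suc n)) - y (Suc n)"
      using rec[of "Suc n"] by simp
    also have "\<dots> = ?A * (?P (int (Suc n)) * y 1 - ?Q (int n) * y 0) -
        (?P (int n) * y 1 - ?Q (int n - 1) * y 0)"
      by (simp only: ge2) simp
    also have "\<dots> = (?A * ?P (int (Suc n)) - ?P (int n)) * y 1 -
        (?A * ?Q (int n) - ?Q (int n - 1)) * y 0"
      (is "_ = ?rhs")
    proof -
      have "?A * (?P (int (Suc n)) * y 1 - ?Q (int n) * y 0) =
          ?A * ?P (int (Suc n)) * y 1 - ?A * ?Q (int n) * y 0"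
        by (subst mult_minus_distrib_mat[OF A mult_carrier_mat[OF P yc] mult_carrier_mat[OF Q yc]])
          (simp only: assoc_mult_mat[OF A P yc] assoc_mult_mat[OF A Q yc])
      moreover have "?rhs = (?A * ?P (int (Suc n)) * y 1 - ?P (int n) * y 1) -
          (?A * ?Q (int n) * y 0 - ?Q (int n - 1) * y 0)"
        by (simp only: minus_mult_distrib_mat[OF mult_carrier_mat[OF A P] P yc]
            minus_mult_distrib_mat[OF mult_carrier_mat[OF A Q] Q yc])
      ultimately show ?thesis
        by (simp only: minus_minus_swap_mat[OF mult_carrier_mat[OF mult_carrier_mat[OF A P] yc]
              mult_carrier_mat[OF P yc] mult_carrier_mat[OF mult_carrier_mat[OF A Q] yc]
              mult_carrier_mat[OF Q yc]])
    qed
    also have "\<dots> = ?P (int (Suc (Suc n))) * y 1 - ?Q (int (Suc n)) * y 0"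
      using left_cheb_Suc[of l "Suc n" a] left_cheb_shift_Suc[of l n a] by simp
    finally show ?case by simp
  qed
qed

text \<open>The factor of a_n sends the column (y_n, y_{n-1}) to (y_{n+1}, y_n), so the product
  carries the initial data to a later pair of consecutive values. Its two block columns are the
  basic solutions with (y_1, y_0) equal to (I, O) and (O, I). The empty product is excluded, again
  because of p_{-2}.\<close>

lemma transfer_mat_eq_left_cheb:
  assumes a: "\<And>n. n \<ge> 1 \<Longrightarrow> a n \<in> carrier_mat l l"
  shows "transfer_mat l a (Suc n) =
    four_block_mat (left_cheb l (int (Suc n)) a) (- left_cheb l (int n) (shift_seq a))
      (left_cheb l (int n) a) (- left_cheb l (int n - 1) (shift_seq a))"
proof -
  have P: "left_cheb l j a \<in> carrier_mat l l" for j
    by (intro left_cheb_carrier a)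
  have Q: "left_cheb l j (shift_seq a) \<in> carrier_mat l l" for j
    by (intro left_cheb_carrier shift_seq_carrier a)
  show ?thesis
  proof (induction n)
    case 0
    have A: "a 1 \<in> carrier_mat l l" by (intro a) simp
    have "left_cheb l 1 a = a 1"
      using left_cheb_Suc[of l 0 a] A by (auto simp: left_cheb_0 left_cheb_minus_one)
    moreover have "four_block_mat (a 1) (- 1\<^sub>m l) (1\<^sub>m l) (0\<^sub>m l l) * 1\<^sub>m (l + l) =
        four_block_mat (a 1) (- 1\<^sub>m l) (1\<^sub>m l) (0\<^sub>m l l)"
      using A by (intro right_mult_one_mat four_block_carrier_mat) auto
    ultimately show ?case by (simp add: left_cheb_0 left_cheb_minus_one)
  next
    case (Suc n)
    let ?A = "a (n + 2)"
    let ?P = "\<lambda>j. left_cheb l j a" and ?Q = "\<lambda>j. left_cheb l j (shift_seq a)"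
    have A: "?A \<in> carrier_mat l l" by (intro a) simp
    have "transfer_mat l a (Suc (Suc n)) = four_block_mat ?A (- 1\<^sub>m l) (1\<^sub>m l) (0\<^sub>m l l) *
        four_block_mat (?P (int (Suc n))) (- ?Q (int n)) (?P (int n)) (- ?Q (int n - 1))"
      using Suc.IH by simp
    also have "\<dots> = four_block_mat
        (?A * ?P (int (Suc n)) + - 1\<^sub>m l * ?P (int n)) (?A * - ?Q (int n) + - 1\<^sub>m l * - ?Q (int n - 1))
        (1\<^sub>m l * ?P (int (Suc n)) + 0\<^sub>m l l * ?P (int n)) (1\<^sub>m l * - ?Q (int n) + 0\<^sub>m l l * - ?Q (int n - 1))"
      using A P Q by (intro mult_four_block_mat[of _ l l _ l _ l _ _ l _ l]) auto
    also have "?A * ?P (int (Suc n)) + - 1\<^sub>m l * ?P (int n) = ?P (int (Suc (Suc n)))"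
    proof -
      have "- 1\<^sub>m l * ?P (int n) = - ?P (int n)"
        using carrier_matD[OF P[of "int n"]] by auto
      then show ?thesis
        using left_cheb_Suc[of l "Suc n" a] A P[of "int (Suc n)"] P[of "int n"]
        by (intro eq_matI) auto
    qed
    also have "?A * - ?Q (int n) + - 1\<^sub>m l * - ?Q (int n - 1) = - ?Q (int (Suc n))"
    proof -
      have "- 1\<^sub>m l * - ?Q (int n - 1) = ?Q (int n - 1)"
        using carrier_matD[OF Q[of "int n - 1"]] by auto
      then show ?thesis
        using left_cheb_shift_Suc[of l n a] A Q[of "int n"] Q[of "int n - 1"]
        by (intro eq_matI) auto
    qed
    also have "1\<^sub>m l * ?P (int (Suc n)) + 0\<^sub>m l l * ?P (int n) = ?P (int (Suc n))"
      using P[of "int (Suc n)"] P[of "int n"] by (auto simp del: of_nat_Suc)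
    also have "1\<^sub>m l * - ?Q (int n) + 0\<^sub>m l l * - ?Q (int n - 1) = - ?Q (int n)"
      using Q[of "int n"] Q[of "int n - 1"] by auto
    finally show ?case by simp
  qed
qed

text \<open>Subtracting N repeatedly brings any index into the first period.\<close>

lemma periodic_commute:
  fixes a :: "nat \<Rightarrow> 'a::semiring_0 mat"
  assumes "N \<ge> 1" and per: "\<And>n. n \<ge> 1 \<Longrightarrow> a (n + N) = a n"
    and comm: "\<And>k. k \<in> {1..N} \<Longrightarrow> m * a k = a k * m" and "n \<ge> 1"
  shows "m * a n = a n * m"
  using \<open>n \<ge> 1\<close>
proof (induction n rule: less_induct)
  case (less n)
  show ?case
  proof (cases "n \<le> N")
    case False
    then show ?thesis
      using less.IH[of "n - N"] per[of "n - N"] \<open>N \<ge> 1\<close> by simp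
  qed (use comm less.prems in simp)
qed

text \<open>The sequences \<open>y (k + N)\<close> and \<open>m * y k\<close> satisfy the same
  recurrence, the first by periodicity and the second because m can be moved past the coefficients.
  They agree at k = 0 and k = 1, hence everywhere.\<close>

lemma is_monodromyI:
  assumes a: "\<And>n. n \<ge> 1 \<Longrightarrow> a n \<in> carrier_mat l l" and m: "m \<in> carrier_mat l l"
    and per: "\<And>n. n \<ge> 1 \<Longrightarrow> a (n + N) = a n"
    and comm: "\<And>n. n \<ge> 1 \<Longrightarrow> m * a n = a n * m"
    and y: "is_solution l a y" and y0: "y N = m * y 0" and y1: "y (Suc N) = m * y 1"
  shows "is_monodromy N m y"
proof -
  have yc: "y k \<in> carrier_mat l l" for k
    using y by (simp add: is_solution_def)
  have rec: "y (k + 2) = a (k + 1) * y (k + 1) - y k" for k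
    using y[unfolded is_solution_def] by (auto dest: spec[of _ "k + 1"])
  have "y (k + N) = m * y k" for k
  proof (induction k rule: induct_nat_012)
    case (ge2 k)
    have A: "a (k + 1) \<in> carrier_mat l l" by (intro a) simp
    have "y (Suc (Suc k) + N) = a (k + 1 + N) * y (Suc k + N) - y (k + N)"
      using rec[of "k + N"] by (simp add: add_ac)
    also have "\<dots> = a (k + 1) * (m * y (Suc k)) - m * y k"
      by (subst per) (simp_all add: ge2[simplified])
    also have "a (k + 1) * (m * y (Suc k)) = m * (a (k + 1) * y (Suc k))"
      using comm[of "k + 1"] by (simp add: assoc_mult_mat[OF A m yc, symmetric, simplified]
          assoc_mult_mat[OF m A yc, symmetric, simplified])
    also have "\<dots> - m * y k = m * (a (k + 1) * y (Suc k) - y k)"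
      by (rule mult_minus_distrib_mat[OF m mult_carrier_mat[OF A yc] yc, symmetric])
    also have "\<dots> = m * y (Suc (Suc k))"
      using rec[of k] by simp
    finally show ?case .
  qed (use y0 y1 in simp_all)
  then show ?thesis by (simp add: is_monodromy_def)
qed

theorem proposition48:
  fixes l N :: nat and a :: "nat \<Rightarrow> complex mat" and m :: "complex mat"
  assumes "l \<ge> 1" and "N \<ge> 1"
    and "\<And>n. n \<ge> 1 \<Longrightarrow> a n \<in> carrier_mat l l"
    and "\<And>n. n \<ge> 1 \<Longrightarrow> a (n + N) = a n"
    and "m \<in> carrier_mat l l"
    and "\<And>k. k \<in> {1..N} \<Longrightarrow> m * a k = a k * m"
  shows "((\<forall>y. is_solution l a y \<longrightarrow> is_monodromy N m y) \<longleftrightarrow>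
            left_cheb l (int N - 1) a = 0\<^sub>m l l \<and>
            left_cheb l (int N - 2) (shift_seq a) = - m \<and>
            left_cheb l (int N) a = m \<and>
            left_cheb l (int N - 1) (shift_seq a) = 0\<^sub>m l l)
       \<and> ((\<forall>y. is_solution l a y \<longrightarrow> is_monodromy N m y) \<longrightarrow>
            transfer_mat l a N = four_block_mat m (0\<^sub>m l l) (0\<^sub>m l l) m)"
proof -
  let ?P = "\<lambda>j. left_cheb l j a" and ?Q = "\<lambda>j. left_cheb l j (shift_seq a)"
  let ?mono = "\<forall>y. is_solution l a y \<longrightarrow> is_monodromy N m y"
  let ?cond = "?P (int N - 1) = 0\<^sub>m l l \<and> ?Q (int N - 2) = - m \<and>
    ?P (int N) = m \<and> ?Q (int N - 1) = 0\<^sub>m l l"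
  note a = assms(3) and m = assms(5)
  obtain K where K: "N = Suc K" using assms(2) by (cases N) auto
  have Q: "?Q j \<in> carrier_mat l l" for j
    by (intro left_cheb_carrier shift_seq_carrier a)
  have neg: "X = - Y" if "- X = Y" "X \<in> carrier_mat l l" for X Y :: "complex mat"
    using that by auto
  have to_cond: ?cond if mono: ?mono
  proof -
    have "is_monodromy N m (\<lambda>n. ?P (int n - 1))"
      using mono is_solution_left_cheb[of a l] a by blast
    then have "?P (int (k + N) - 1) = m * ?P (int k - 1)" for k
      by (simp add: is_monodromy_def)
    \<comment> \<open>This solution starts with O, I, so its values at N and N + 1 are m O and m
      I.\<close>
    from this[of 0] this[of 1] have P: "?P (int N - 1) = 0\<^sub>m l l" "?P (int N) = m"
      using m by (simp_all add: left_cheb_0 left_cheb_minus_one)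
    have "is_monodromy N m (\<lambda>n. if n = 0 then 1\<^sub>m l else - ?Q (int n - 2))"
      using mono is_solution_left_cheb_shift[of a l] a by blast
    \<comment> \<open>As N \<ge> 1, the index k + N is never 0, so the exceptional value I can occur
      only on the right. At k = 0 it yields m, and k = 1 yields O.\<close>
    then have "- ?Q (int (k + N) - 2) = m * (if k = 0 then 1\<^sub>m l else - ?Q (int k - 2))" for k
      using assms(2) unfolding is_monodromy_def by (auto dest: spec[of _ k])
    from this[of 0] this[of 1] have "- ?Q (int N - 2) = m" "- ?Q (int N - 1) = 0\<^sub>m l l"
      using m by (simp_all add: left_cheb_minus_one)
    then have "?Q (int N - 2) = - m" "?Q (int N - 1) = - 0\<^sub>m l l"
      by (blast intro: neg Q)+
    with P show ?cond by simp
  qed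
  moreover have ?mono if cond: ?cond
  proof (intro allI impI)
    fix y assume y: "is_solution l a y"
    then have yc: "y k \<in> carrier_mat l l" for k
      by (simp add: is_solution_def)
    note eq = solution_eq_left_cheb[OF a y]
    \<comment> \<open>The first pair of conditions gives the coefficients of y_N, the second pair
      those of y_{N+1}.\<close>
    have "y N = 0\<^sub>m l l * y 1 - (- m) * y 0"
      using eq[of K] cond K by simp
    also have "\<dots> = m * y 0"
      using yc[of 0] yc[of 1] m by (intro eq_matI) auto
    finally have "y N = m * y 0" .
    moreover have "y (Suc N) = m * y 1 - 0\<^sub>m l l * y 0"
      using eq[of N] cond by simp
    then have "y (Suc N) = m * y 1"
      using yc[of 0] yc[of 1] m by auto
    moreover have "m * a n = a n * m" if "n \<ge> 1" for n
      using periodic_commute[of N a m n] assms that by blast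
    ultimately show "is_monodromy N m y"
      using is_monodromyI[of a l m N y] a m assms(4) y by blast
  qed
  \<comment> \<open>The four conditions prescribe, up to sign, exactly the four blocks of the
    transfer matrix.\<close>
  moreover have "transfer_mat l a N = four_block_mat m (0\<^sub>m l l) (0\<^sub>m l l) m" if ?mono
    using to_cond[OF that] transfer_mat_eq_left_cheb[of a l K] a K m by simp
  ultimately show ?thesis by blast
qed

end
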